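(* $A_{0}+AP_{+}$ is not a GCD domain.
   Context: $\mathbb{C}_{\geq 0}=\{s\in\mathbb{C}:\operatorname{Re}(s)\geq 0\}$ and $\mathbb{C}_{>0}=\{s\in\mathbb{C}:\operatorname{Re}(s)>0\}$. $A_{0}$ is the set of functions $f:\mathbb{C}_{\geq 0}\to\mathbb{C}$ that are holomorphic in $\mathbb{C}_{>0}$, continuous on $\mathbb{C}_{\geq 0}$, and satisfy $\lim_{s\to\infty}f(s)=0$ (limit as $|s|\to\infty$ in $\mathbb{C}_{\geq 0}$). $AP_{+}$ (causal almost periodic functions) is the closure, in the supremum norm on $\mathbb{C}_{\geq 0}$, of the complex linear span of the functions $s\mapsto e^{-st}$, $t\geq 0$. $A_{0}+AP_{+}=\{f:\mathbb{C}_{\geq 0}\to\mathbb{C}: f=f_{A_0}+f_{AP_+},\ f_{A_0}\in A_0,\ f_{AP_+}\in AP_+\}$ is a Banach algebra with pointwise operations and the supremum norm; it is an integral domain. Let $R$ be an integral domain (a commutative unital ring with no zero divisors). An element $d\in R$ is a greatest common divisor (gcd) of $a,b\in R$ if $d$ divides $a$ and $b$ and every common divisor $k$ of $a$ and $b$ divides $d$. $R$ is a GCD domain if every pair $a,b\in R$ has a gcd. *)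

theory Defs
  imports
    "HOL-Complex_Analysis.Complex_Analysis"
    "HOL-Algebra.Ring"
    "HOL-Algebra.Divisibility"
    "HOL-Library.FuncSet"
begin

definition cge0 :: "complex set" where
  "cge0 = {s. 0 \<le> Re s}"

definition cgt0 :: "complex set" where
  "cgt0 = {s. 0 < Re s}"

text \<open>Functions with domain \<^term>\<open>cge0\<close> are represented by the elements of
  \<^term>\<open>extensional cge0\<close>, which take the value \<^term>\<open>undefined\<close> off \<^term>\<open>cge0\<close>. Thus
  equality of functions is equality on \<^term>\<open>cge0\<close>, and the zero and unit of the ring below are
  the constant functions on \<^term>\<open>cge0\<close>.\<close>

definition A0 :: "(complex \<Rightarrow> complex) set" where
  "A0 = {f \<in> extensional cge0. f holomorphic_on cgt0 \<and> continuous_on cge0 f \<and>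
           (f \<longlongrightarrow> 0) (inf at_infinity (principal cge0))}"

definition exp_span :: "(complex \<Rightarrow> complex) set" where
  "exp_span = {f. \<exists>T c. finite T \<and> T \<subseteq> {0..} \<and>
      f = (\<lambda>s\<in>cge0. \<Sum>t\<in>T. c t * exp (- s * complex_of_real t))}"

text \<open>The condition says that \<^term>\<open>f\<close> has supremum-norm distance 0 from
  \<^term>\<open>exp_span\<close>.\<close>

definition AP_plus :: "(complex \<Rightarrow> complex) set" where
  "AP_plus = {f \<in> extensional cge0.
      \<forall>\<epsilon>>0. \<exists>p\<in>exp_span. \<forall>s\<in>cge0. norm (f s - p s) \<le> \<epsilon>}"

definition A0_AP :: "(complex \<Rightarrow> complex) set" where
  "A0_AP = {f. \<exists>g\<in>A0. \<exists>h\<in>AP_plus. f = (\<lambda>s\<in>cge0. g s + h s)}"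

definition A0_AP_ring :: "(complex \<Rightarrow> complex) ring" where
  "A0_AP_ring =
    \<lparr> carrier = A0_AP,
      monoid.mult = (\<lambda>f g. \<lambda>s\<in>cge0. f s * g s),
      one = (\<lambda>s\<in>cge0. 1),
      zero = (\<lambda>s\<in>cge0. 0),
      add = (\<lambda>f g. \<lambda>s\<in>cge0. f s + g s) \<rparr>"

text \<open>The ring itself is used here, rather than its monoid of nonzero elements: pairs
  containing zero are included, as in the definition of a GCD domain.\<close>

locale gcd_domain = domain +
  assumes gcd_exists:
    "\<lbrakk>a \<in> carrier R; b \<in> carrier R\<rbrakk> \<Longrightarrow> \<exists>d\<in>carrier R. d gcdof a b"


subsection \<open>The ring is an integral domain\<close>

text \<open>Hence failing to be a GCD domain can only mean that some pair has no gcd.\<close>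

lemma exp_spanI:
  assumes "finite I" "\<And>i. i \<in> I \<Longrightarrow> 0 \<le> \<tau> i"
    and "f = (\<lambda>s\<in>cge0. \<Sum>i\<in>I. a i * exp (- s * complex_of_real (\<tau> i)))"
  shows "f \<in> exp_span"
proof -
  have "(\<Sum>i\<in>I. a i * exp (- s * complex_of_real (\<tau> i)))
      = (\<Sum>t\<in>\<tau> ` I. (\<Sum>i\<in>{i\<in>I. \<tau> i = t}. a i) * exp (- s * complex_of_real t))" for s
    unfolding sum.image_gen[OF assms(1), of "\<lambda>i. a i * exp (- s * complex_of_real (\<tau> i))" \<tau>]
    by (auto simp: sum_distrib_right intro!: sum.cong)
  then show ?thesis
    unfolding exp_span_def using assms
    by (auto intro!: exI[of _ "\<tau> ` I"] exI[of _ "\<lambda>t. \<Sum>i\<in>{i\<in>I. \<tau> i = t}. a i"])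
qed

lemma exp_spanE:
  assumes "f \<in> exp_span"
  obtains T c where "finite T" "\<And>t. t \<in> T \<Longrightarrow> 0 \<le> t"
    "\<And>s. s \<in> cge0 \<Longrightarrow> f s = (\<Sum>t\<in>T. c t * exp (- s * complex_of_real t))"
proof -
  obtain T c where *: "finite T" "T \<subseteq> {0..}"
    "f = (\<lambda>s\<in>cge0. \<Sum>t\<in>T. c t * exp (- s * complex_of_real t))"
    using assms unfolding exp_span_def by blast
  show thesis by (rule that[of T c]) (use * in auto)
qed

lemma exp_span_const: "(\<lambda>s\<in>cge0. c) \<in> exp_span"
  by (rule exp_spanI[where I = "{0::real}" and \<tau> = "\<lambda>_. 0" and a = "\<lambda>_. c"]) auto

lemma exp_span_add:
  assumes "f \<in> exp_span" "g \<in> exp_span"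
  shows "(\<lambda>s\<in>cge0. f s + g s) \<in> exp_span"
proof -
  obtain T c where T: "finite T" "\<And>t. t \<in> T \<Longrightarrow> 0 \<le> t"
    "\<And>s. s \<in> cge0 \<Longrightarrow> f s = (\<Sum>t\<in>T. c t * exp (- s * complex_of_real t))"
    by (rule exp_spanE[OF assms(1)]) blast
  obtain U d where U: "finite U" "\<And>t. t \<in> U \<Longrightarrow> 0 \<le> t"
    "\<And>s. s \<in> cge0 \<Longrightarrow> g s = (\<Sum>t\<in>U. d t * exp (- s * complex_of_real t))"
    by (rule exp_spanE[OF assms(2)]) blast
  show ?thesis
    by (rule exp_spanI[where I = "T <+> U" and \<tau> = "case_sum id id" and a = "case_sum c d"])
      (use T U in \<open>auto simp: sum.Plus fun_eq_iff restrict_def\<close>)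
qed

lemma exp_span_mult:
  assumes "f \<in> exp_span" "g \<in> exp_span"
  shows "(\<lambda>s\<in>cge0. f s * g s) \<in> exp_span"
proof -
  obtain T c where T: "finite T" "\<And>t. t \<in> T \<Longrightarrow> 0 \<le> t"
    "\<And>s. s \<in> cge0 \<Longrightarrow> f s = (\<Sum>t\<in>T. c t * exp (- s * complex_of_real t))"
    by (rule exp_spanE[OF assms(1)]) blast
  obtain U d where U: "finite U" "\<And>t. t \<in> U \<Longrightarrow> 0 \<le> t"
    "\<And>s. s \<in> cge0 \<Longrightarrow> g s = (\<Sum>t\<in>U. d t * exp (- s * complex_of_real t))"
    by (rule exp_spanE[OF assms(2)]) blast
  show ?thesis
  proof (rule exp_spanI[where I = "T \<times> U" and \<tau> = "\<lambda>(t,u). t + u" and a = "\<lambda>(t,u). c t * d u"])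
    show "(\<lambda>s\<in>cge0. f s * g s) = (\<lambda>s\<in>cge0. \<Sum>i\<in>T \<times> U.
        (case i of (t, u) \<Rightarrow> c t * d u) * exp (- s * complex_of_real (case i of (t, u) \<Rightarrow> t + u)))"
    proof (rule restrict_ext)
      fix s assume s: "s \<in> cge0"
      show "f s * g s = (\<Sum>i\<in>T \<times> U.
        (case i of (t, u) \<Rightarrow> c t * d u) * exp (- s * complex_of_real (case i of (t, u) \<Rightarrow> t + u)))"
        unfolding T(3)[OF s] U(3)[OF s] sum_product sum.cartesian_product
        by (rule sum.cong) (auto simp: algebra_simps exp_add exp_diff exp_minus divide_inverse)
    qed
  qed (use T U in auto)
qed

lemma exp_span_bounded:
  assumes "f \<in> exp_span"
  obtains B where "B > 0" "\<And>s. s \<in> cge0 \<Longrightarrow> norm (f s) \<le> B"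
proof -
  obtain T c where T: "finite T" "\<And>t. t \<in> T \<Longrightarrow> 0 \<le> t"
    "\<And>s. s \<in> cge0 \<Longrightarrow> f s = (\<Sum>t\<in>T. c t * exp (- s * complex_of_real t))"
    by (rule exp_spanE[OF assms(1)]) blast
  have "norm (f s) \<le> (\<Sum>t\<in>T. norm (c t)) + 1" if s: "s \<in> cge0" for s
  proof -
    have "norm (f s) \<le> (\<Sum>t\<in>T. norm (c t))"
      unfolding T(3)[OF s]
    proof (rule sum_norm_le)
      fix t assume "t \<in> T"
      then have "norm (exp (- s * complex_of_real t)) \<le> 1"
        using T(2) s by (simp add: norm_exp_eq_Re cge0_def)
      then show "norm (c t * exp (- s * complex_of_real t)) \<le> norm (c t)"
        by (simp add: norm_mult mult_left_le)
    qed
    then show ?thesis by simp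
  qed
  moreover have "0 < (\<Sum>t\<in>T. norm (c t)) + 1"
    by (simp add: sum_nonneg add_nonneg_pos)
  ultimately show thesis using that by blast
qed

lemma cgt0_subset: "cgt0 \<subseteq> cge0"
  by (auto simp: cgt0_def cge0_def)

lemma open_cgt0: "open cgt0"
  unfolding cgt0_def by (rule open_halfspace_Re_gt)

lemma connected_cgt0: "connected cgt0"
  unfolding cgt0_def by (intro convex_connected convex_halfspace_Re_gt)

lemma closure_cgt0: "closure cgt0 = cge0"
  using closure_halfspace_gt[of "1::complex" 0] by (simp add: cgt0_def cge0_def)

lemma exp_span_continuous:
  assumes "f \<in> exp_span" shows "continuous_on cge0 f"
proof -
  obtain T c where T: "\<And>s. s \<in> cge0 \<Longrightarrow> f s = (\<Sum>t\<in>T. c t * exp (- s * complex_of_real t))"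
    by (rule exp_spanE[OF assms(1)]) blast
  show ?thesis
    by (subst continuous_on_cong[OF refl T]) (auto intro!: continuous_intros)
qed

lemma exp_span_holomorphic:
  assumes "f \<in> exp_span" shows "f holomorphic_on cgt0"
proof -
  obtain T c where T: "\<And>s. s \<in> cge0 \<Longrightarrow> f s = (\<Sum>t\<in>T. c t * exp (- s * complex_of_real t))"
    by (rule exp_spanE[OF assms(1)]) blast
  have "(\<lambda>s. \<Sum>t\<in>T. c t * exp (- s * complex_of_real t)) holomorphic_on cgt0"
    by (intro holomorphic_intros)
  then show ?thesis
    by (rule holomorphic_transform) (use T cgt0_subset in auto)
qed

lemma exp_span_subset_AP: "exp_span \<subseteq> AP_plus"
proof
  fix f assume f: "f \<in> exp_span"
  then have "f \<in> extensional cge0" by (auto simp: exp_span_def)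
  moreover have "\<exists>p\<in>exp_span. \<forall>s\<in>cge0. norm (f s - p s) \<le> \<epsilon>" if "\<epsilon> > 0" for \<epsilon>
    using f that by (intro bexI[of _ f]) auto
  ultimately show "f \<in> AP_plus" by (simp add: AP_plus_def)
qed

lemma AP_approx:
  assumes "f \<in> AP_plus" "\<epsilon> > 0"
  obtains p where "p \<in> exp_span" "\<And>s. s \<in> cge0 \<Longrightarrow> norm (f s - p s) \<le> \<epsilon>"
  using assms unfolding AP_plus_def by blast

lemma AP_bounded:
  assumes "f \<in> AP_plus"
  obtains B where "B > 0" "\<And>s. s \<in> cge0 \<Longrightarrow> norm (f s) \<le> B"
proof -
  obtain p where p: "p \<in> exp_span" "\<And>s. s \<in> cge0 \<Longrightarrow> norm (f s - p s) \<le> 1"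
    using AP_approx[OF assms, of 1] by auto
  obtain B where B: "B > 0" "\<And>s. s \<in> cge0 \<Longrightarrow> norm (p s) \<le> B"
    using exp_span_bounded[OF p(1)] by blast
  have "norm (f s) \<le> B + 1" if "s \<in> cge0" for s
    using p(2)[OF that] B(2)[OF that] norm_triangle_sub[of "f s" "p s"] by linarith
  with B(1) show thesis using that[of "B + 1"] by simp
qed

lemma AP_uniform_limit:
  assumes "f \<in> AP_plus"
  obtains p where "\<And>n. p n \<in> exp_span" "uniform_limit cge0 p f sequentially"
proof -
  have "\<forall>n. \<exists>p\<in>exp_span. \<forall>s\<in>cge0. norm (f s - p s) \<le> inverse (real (Suc n))"
    using assms unfolding AP_plus_def by simp
  then obtain p where p: "\<And>n. p n \<in> exp_span"
    "\<And>n s. s \<in> cge0 \<Longrightarrow> norm (f s - p n s) \<le> inverse (real (Suc n))"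
    by metis
  have "uniform_limit cge0 p f sequentially"
  proof (rule uniform_limitI)
    fix e :: real assume "e > 0"
    then have "\<forall>\<^sub>F n in sequentially. inverse (real (Suc n)) < e"
      using LIMSEQ_inverse_real_of_nat order_tendstoD(2) by blast
    then show "\<forall>\<^sub>F n in sequentially. \<forall>x\<in>cge0. dist (p n x) (f x) < e"
      by eventually_elim (use p(2) in \<open>auto simp: dist_norm norm_minus_commute intro: le_less_trans\<close>)
  qed
  then show thesis using that p(1) by blast
qed

lemma AP_continuous:
  assumes "f \<in> AP_plus" shows "continuous_on cge0 f"
proof -
  obtain p where p: "\<And>n. p n \<in> exp_span" "uniform_limit cge0 p f sequentially"
    using AP_uniform_limit[OF assms] by blast
  show ?thesis
    by (rule uniform_limit_theorem[OF _ p(2)]) (use p(1) exp_span_continuous in auto)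
qed

lemma AP_holomorphic:
  assumes "f \<in> AP_plus" shows "f holomorphic_on cgt0"
proof -
  obtain p where p: "\<And>n. p n \<in> exp_span" "uniform_limit cge0 p f sequentially"
    using AP_uniform_limit[OF assms] by blast
  show ?thesis
  proof (rule holomorphic_uniform_sequence[OF open_cgt0])
    show "p n holomorphic_on cgt0" for n using p(1) exp_span_holomorphic by auto
    fix x assume "x \<in> cgt0"
    then obtain d where "d > 0" "cball x d \<subseteq> cgt0"
      using open_cgt0 open_contains_cball by blast
    moreover have "uniform_limit (cball x d) p f sequentially"
      by (rule uniform_limit_on_subset[OF p(2)]) (use calculation cgt0_subset in auto)
    ultimately show "\<exists>d>0. cball x d \<subseteq> cgt0 \<and> uniform_limit (cball x d) p f sequentially"
      by blast
  qed
qed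

lemma AP_add:
  assumes "f \<in> AP_plus" "g \<in> AP_plus"
  shows "(\<lambda>s\<in>cge0. f s + g s) \<in> AP_plus"
proof -
  have "\<exists>p\<in>exp_span. \<forall>s\<in>cge0. norm ((\<lambda>s\<in>cge0. f s + g s) s - p s) \<le> \<epsilon>" if "\<epsilon> > 0" for \<epsilon>
  proof -
    obtain p where p: "p \<in> exp_span" "\<And>s. s \<in> cge0 \<Longrightarrow> norm (f s - p s) \<le> \<epsilon>/2"
      using AP_approx[OF assms(1), of "\<epsilon>/2"] \<open>\<epsilon> > 0\<close> by auto
    obtain q where q: "q \<in> exp_span" "\<And>s. s \<in> cge0 \<Longrightarrow> norm (g s - q s) \<le> \<epsilon>/2"
      using AP_approx[OF assms(2), of "\<epsilon>/2"] \<open>\<epsilon> > 0\<close> by auto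
    show ?thesis
    proof (intro bexI[of _ "\<lambda>s\<in>cge0. p s + q s"] ballI exp_span_add p q)
      fix s assume s: "s \<in> cge0"
      show "norm ((\<lambda>s\<in>cge0. f s + g s) s - (\<lambda>s\<in>cge0. p s + q s) s) \<le> \<epsilon>"
        using norm_diff_triangle_ineq[of "f s" "g s" "p s" "q s"] p(2)[OF s] q(2)[OF s] s by simp
    qed
  qed
  then show ?thesis unfolding AP_plus_def by auto
qed

lemma AP_mult:
  assumes "f \<in> AP_plus" "g \<in> AP_plus"
  shows "(\<lambda>s\<in>cge0. f s * g s) \<in> AP_plus"
proof -
  have "\<exists>p\<in>exp_span. \<forall>s\<in>cge0. norm ((\<lambda>s\<in>cge0. f s * g s) s - p s) \<le> \<epsilon>" if "\<epsilon> > 0" for \<epsilon>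
  proof -
    obtain B where B: "B > 0" "\<And>s. s \<in> cge0 \<Longrightarrow> norm (g s) \<le> B"
      using AP_bounded[OF assms(2)] by blast
    obtain p where p: "p \<in> exp_span" "\<And>s. s \<in> cge0 \<Longrightarrow> norm (f s - p s) \<le> \<epsilon>/(2*B)"
      using AP_approx[OF assms(1), of "\<epsilon>/(2*B)"] \<open>\<epsilon> > 0\<close> B by auto
    obtain C where C: "C > 0" "\<And>s. s \<in> cge0 \<Longrightarrow> norm (p s) \<le> C"
      using exp_span_bounded[OF p(1)] by blast
    obtain q where q: "q \<in> exp_span" "\<And>s. s \<in> cge0 \<Longrightarrow> norm (g s - q s) \<le> \<epsilon>/(2*C)"
      using AP_approx[OF assms(2), of "\<epsilon>/(2*C)"] \<open>\<epsilon> > 0\<close> C by auto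
    show ?thesis
    proof (intro bexI[of _ "\<lambda>s\<in>cge0. p s * q s"] ballI exp_span_mult p q)
      fix s assume s: "s \<in> cge0"
      have "f s * g s - p s * q s = (f s - p s) * g s + p s * (g s - q s)"
        by (simp add: algebra_simps)
      then have "norm (f s * g s - p s * q s) \<le> norm (f s - p s) * norm (g s) + norm (p s) * norm (g s - q s)"
        by (metis norm_mult norm_triangle_ineq)
      also have "\<dots> \<le> \<epsilon>/(2*B) * B + C * (\<epsilon>/(2*C))"
        using p(2)[OF s] q(2)[OF s] B(2)[OF s] C(2)[OF s] B(1) C(1) \<open>\<epsilon> > 0\<close>
        by (intro add_mono mult_mono) auto
      also have "\<dots> = \<epsilon>" using B(1) C(1) by simp
      finally show "norm ((\<lambda>s\<in>cge0. f s * g s) s - (\<lambda>s\<in>cge0. p s * q s) s) \<le> \<epsilon>"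
        using s by simp
    qed
  qed
  then show ?thesis unfolding AP_plus_def by auto
qed

lemma eventually_cge0: "\<forall>\<^sub>F s in inf at_infinity (principal cge0). s \<in> cge0"
  by (simp add: eventually_inf_principal)

lemma A0_I:
  assumes "f holomorphic_on cgt0" "continuous_on cge0 f"
    and "(f \<longlongrightarrow> 0) (inf at_infinity (principal cge0))"
  shows "(\<lambda>s\<in>cge0. f s) \<in> A0"
proof -
  have "(\<lambda>s\<in>cge0. f s) holomorphic_on cgt0"
    by (rule holomorphic_transform[OF assms(1)]) (use cgt0_subset in auto)
  moreover have "continuous_on cge0 (\<lambda>s\<in>cge0. f s)"
    using assms(2) by (subst continuous_on_cong[OF refl, of _ _ f]) auto
  moreover have "((\<lambda>s\<in>cge0. f s) \<longlongrightarrow> 0) (inf at_infinity (principal cge0))"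
    using assms(3) by (rule Lim_transform_eventually)
      (use eventually_cge0 in \<open>auto elim!: eventually_mono\<close>)
  ultimately show ?thesis by (simp add: A0_def)
qed

lemma A0_zero: "(\<lambda>s\<in>cge0. 0) \<in> A0"
  by (rule A0_I) auto

lemma A0_add:
  assumes "f \<in> A0" "g \<in> A0" shows "(\<lambda>s\<in>cge0. f s + g s) \<in> A0"
  by (rule A0_I) (use assms in \<open>auto simp: A0_def intro!: holomorphic_intros continuous_intros
    intro: tendsto_add_zero\<close>)

lemma A0_mult_A0:
  assumes "f \<in> A0" "g \<in> A0" shows "(\<lambda>s\<in>cge0. f s * g s) \<in> A0"
  by (rule A0_I) (use assms in \<open>auto simp: A0_def intro!: holomorphic_intros continuous_intros
    intro: tendsto_mult_zero\<close>)

lemma A0_mult_AP: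
  assumes "f \<in> A0" "g \<in> AP_plus" shows "(\<lambda>s\<in>cge0. f s * g s) \<in> A0"
proof (rule A0_I)
  show "(\<lambda>s. f s * g s) holomorphic_on cgt0"
    using assms AP_holomorphic by (auto simp: A0_def intro!: holomorphic_intros)
  show "continuous_on cge0 (\<lambda>s. f s * g s)"
    using assms AP_continuous by (auto simp: A0_def intro!: continuous_intros)
  obtain B where B: "B > 0" "\<And>s. s \<in> cge0 \<Longrightarrow> norm (g s) \<le> B"
    using AP_bounded[OF assms(2)] by blast
  have "Zfun f (inf at_infinity (principal cge0))"
    using assms(1) by (simp add: A0_def tendsto_Zfun_iff)
  moreover have "Bfun g (inf at_infinity (principal cge0))"
    by (rule BfunI[of _ B]) (use eventually_cge0 B(2) in \<open>auto elim!: eventually_mono\<close>)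
  ultimately have "Zfun (\<lambda>s. f s * g s) (inf at_infinity (principal cge0))"
    by (rule bounded_bilinear.Zfun_prod_Bfun[OF bounded_bilinear_mult])
  then show "((\<lambda>s. f s * g s) \<longlongrightarrow> 0) (inf at_infinity (principal cge0))"
    by (simp add: tendsto_Zfun_iff)
qed

lemma A0_APE:
  assumes "f \<in> A0_AP"
  obtains g h where "g \<in> A0" "h \<in> AP_plus" "f = (\<lambda>s\<in>cge0. g s + h s)"
  using assms unfolding A0_AP_def by blast

lemma A0_AP_extensional: "f \<in> A0_AP \<Longrightarrow> f \<in> extensional cge0"
  by (auto simp: A0_AP_def)

lemma A0_AP_const: "(\<lambda>s\<in>cge0. c) \<in> A0_AP"
proof -
  have "(\<lambda>s\<in>cge0. c) = (\<lambda>s\<in>cge0. (\<lambda>s\<in>cge0. 0) s + (\<lambda>s\<in>cge0. c) s)"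
    by (auto simp: fun_eq_iff restrict_def)
  then show ?thesis
    unfolding A0_AP_def using A0_zero exp_span_const[of c] exp_span_subset_AP by blast
qed

lemma A0_AP_add:
  assumes "f \<in> A0_AP" "f' \<in> A0_AP" shows "(\<lambda>s\<in>cge0. f s + f' s) \<in> A0_AP"
proof -
  obtain g h where f: "g \<in> A0" "h \<in> AP_plus" "f = (\<lambda>s\<in>cge0. g s + h s)"
    by (rule A0_APE[OF assms(1)])
  obtain g' h' where f': "g' \<in> A0" "h' \<in> AP_plus" "f' = (\<lambda>s\<in>cge0. g' s + h' s)"
    by (rule A0_APE[OF assms(2)])
  have "(\<lambda>s\<in>cge0. f s + f' s)
      = (\<lambda>s\<in>cge0. (\<lambda>s\<in>cge0. g s + g' s) s + (\<lambda>s\<in>cge0. h s + h' s) s)"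
    by (auto simp: f(3) f'(3) fun_eq_iff restrict_def)
  then show ?thesis
    unfolding A0_AP_def using A0_add[OF f(1) f'(1)] AP_add[OF f(2) f'(2)] by blast
qed

lemma A0_AP_mult:
  assumes "f \<in> A0_AP" "f' \<in> A0_AP" shows "(\<lambda>s\<in>cge0. f s * f' s) \<in> A0_AP"
proof -
  obtain g h where f: "g \<in> A0" "h \<in> AP_plus" "f = (\<lambda>s\<in>cge0. g s + h s)"
    by (rule A0_APE[OF assms(1)])
  obtain g' h' where f': "g' \<in> A0" "h' \<in> AP_plus" "f' = (\<lambda>s\<in>cge0. g' s + h' s)"
    by (rule A0_APE[OF assms(2)])
  let ?k = "\<lambda>s\<in>cge0. (\<lambda>s\<in>cge0. (\<lambda>s\<in>cge0. g s * g' s) s + (\<lambda>s\<in>cge0. g s * h' s) s) s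
    + (\<lambda>s\<in>cge0. g' s * h s) s"
  have "?k \<in> A0"
    by (intro A0_add A0_mult_A0 A0_mult_AP f f')
  moreover have "(\<lambda>s\<in>cge0. f s * f' s) = (\<lambda>s\<in>cge0. ?k s + (\<lambda>s\<in>cge0. h s * h' s) s)"
    by (auto simp: f(3) f'(3) fun_eq_iff restrict_def algebra_simps)
  ultimately show ?thesis
    unfolding A0_AP_def using AP_mult[OF f(2) f'(2)] by blast
qed

lemma A0_AP_continuous:
  assumes "f \<in> A0_AP" shows "continuous_on cge0 f"
proof -
  obtain g h where f: "g \<in> A0" "h \<in> AP_plus" "f = (\<lambda>s\<in>cge0. g s + h s)"
    by (rule A0_APE[OF assms(1)])
  have "continuous_on cge0 (\<lambda>s. g s + h s)"
    using f AP_continuous by (auto simp: A0_def intro!: continuous_intros)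
  then show ?thesis
    by (subst continuous_on_cong[OF refl, of _ _ "\<lambda>s. g s + h s"]) (auto simp: f(3))
qed

lemma A0_AP_holomorphic:
  assumes "f \<in> A0_AP" shows "f holomorphic_on cgt0"
proof -
  obtain g h where f: "g \<in> A0" "h \<in> AP_plus" "f = (\<lambda>s\<in>cge0. g s + h s)"
    by (rule A0_APE[OF assms(1)])
  have "(\<lambda>s. g s + h s) holomorphic_on cgt0"
    using f AP_holomorphic by (auto simp: A0_def intro!: holomorphic_intros)
  then show ?thesis
    by (rule holomorphic_transform) (use f(3) cgt0_subset in auto)
qed

lemma A0_AP_eq_zero:
  assumes "f \<in> A0_AP" "\<And>s. s \<in> cgt0 \<Longrightarrow> f s = 0"
  shows "f = (\<lambda>s\<in>cge0. 0)"
proof (rule extensionalityI[OF A0_AP_extensional[OF assms(1)]])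
  fix s assume "s \<in> cge0"
  then have "f s = 0"
    using continuous_constant_on_closure[of cgt0 f 0 s] assms A0_AP_continuous closure_cgt0
    by auto
  with \<open>s \<in> cge0\<close> show "f s = (\<lambda>s\<in>cge0. 0) s" by simp
qed auto

lemma A0_AP_integral:
  assumes "f \<in> A0_AP" "g \<in> A0_AP" and fg: "(\<lambda>s\<in>cge0. f s * g s) = (\<lambda>s\<in>cge0. 0)"
  shows "f = (\<lambda>s\<in>cge0. 0) \<or> g = (\<lambda>s\<in>cge0. 0)"
proof (cases "\<forall>s\<in>cgt0. f s = 0")
  case True
  then show ?thesis using A0_AP_eq_zero[OF assms(1)] by blast
next
  case False
  then obtain z where z: "z \<in> cgt0" "f z \<noteq> 0" by blast
  define U where "U = f -` (- {0}) \<inter> cgt0"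
  have "open U"
    unfolding U_def
    using continuous_on_open_vimage[OF open_cgt0, of f]
      holomorphic_on_imp_continuous_on[OF A0_AP_holomorphic[OF assms(1)]] by auto
  moreover have "U \<noteq> {}" "U \<subseteq> cgt0" using z by (auto simp: U_def)
  moreover have "g s = 0" if "s \<in> U" for s
    using fun_cong[OF fg, of s] that cgt0_subset by (auto simp: U_def)
  ultimately have "g s = 0" if "s \<in> cgt0" for s
    using analytic_continuation_open[of U cgt0 g "\<lambda>_. 0" s] open_cgt0 connected_cgt0
      A0_AP_holomorphic[OF assms(2)] that by auto
  then show ?thesis using A0_AP_eq_zero[OF assms(2)] by blast
qed

lemma A0_AP_domain: "domain A0_AP_ring"
proof (intro domain.intro domain_axioms.intro cringI abelian_groupI comm_monoidI)
  show "\<exists>y\<in>carrier A0_AP_ring. y \<oplus>\<^bsub>A0_AP_ring\<^esub> f = \<zero>\<^bsub>A0_AP_ring\<^esub>"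
    if "f \<in> carrier A0_AP_ring" for f
    using A0_AP_mult[OF A0_AP_const[of "-1"], of f] that
    by (intro bexI[of _ "\<lambda>s\<in>cge0. (\<lambda>s\<in>cge0. - 1) s * f s"]) (auto simp: A0_AP_ring_def fun_eq_iff restrict_def)
  show "\<one>\<^bsub>A0_AP_ring\<^esub> \<noteq> \<zero>\<^bsub>A0_AP_ring\<^esub>"
    by (auto simp: A0_AP_ring_def cge0_def fun_eq_iff restrict_def intro!: exI[of _ 0])
  show "f = \<zero>\<^bsub>A0_AP_ring\<^esub> \<or> g = \<zero>\<^bsub>A0_AP_ring\<^esub>"
    if "f \<otimes>\<^bsub>A0_AP_ring\<^esub> g = \<zero>\<^bsub>A0_AP_ring\<^esub>" "f \<in> carrier A0_AP_ring" "g \<in> carrier A0_AP_ring" for f g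
    using that A0_AP_integral by (simp add: A0_AP_ring_def)
qed (auto simp: A0_AP_ring_def A0_AP_const A0_AP_add A0_AP_mult fun_eq_iff algebra_simps
    extensional_arb[OF A0_AP_extensional] restrict_apply split: if_splits)

end

theory Submission
  imports Defs
begin

text \<open>
  Write \<open>S s = exp (- 1 / s)\<close>, a function that has modulus at most \<open>1\<close> on the closed half
  plane and has no limit at \<open>0\<close>. The pair without a gcd is \<open>q s = s / (s + 1)\<close> and
  \<open>q S\<close>; the zero of \<open>q\<close> makes the second function continuous at \<open>0\<close>, and both tend to \<open>1\<close> at
  infinity.

  Suppose that \<open>d\<close> is a gcd, with \<open>q = d k\<close> and \<open>q S = d l\<close>. Then \<open>l = k S\<close> away from \<open>0\<close>, and
  since \<open>l\<close> is continuous at \<open>0\<close> whereas \<open>S\<close> has no limit there, \<open>k 0 = 0\<close>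
  (\<open>zero_if_exp_recip_multiple_continuous\<close>). If now \<open>k = r\<^sup>2 h\<close> in the ring with \<open>r 0 = 0\<close>, and \<open>r S\<close>
  is in the ring too, then \<open>d r\<close> divides \<open>q\<close> with cofactor \<open>r h\<close> and divides \<open>q S\<close> with cofactor
  \<open>r S h\<close>. Hence \<open>d r\<close> divides \<open>d\<close>, so that \<open>r\<close> is a unit, which contradicts \<open>r 0 = 0\<close>.

  The work lies in factoring \<open>k\<close> in this way (\<open>splits_into_square_times_AP\<close>). As \<open>k d = q\<close> has its
  only zero at \<open>0\<close>, so has \<open>k\<close>, and a square root of \<open>k\<close> exists; but it is not clear that its
  behaviour at infinity is that of an almost periodic function plus a null function. The almost
  periodic parts of \<open>k\<close> and \<open>d\<close> repair this: their product differs from \<open>k d\<close> by a function that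
  vanishes at infinity, so it tends to \<open>1\<close> there, and an almost periodic function with a limit at
  infinity is constant. Thus the almost periodic parts \<open>h\<close> and \<open>h'\<close> of \<open>k\<close> and \<open>d\<close> are mutually
  inverse, the function \<open>k h'\<close> tends to \<open>1\<close> at infinity, and its square root \<open>r\<close>, continuous up to
  infinity, satisfies \<open>k = (k h') h = r\<^sup>2 h\<close>.
\<close>

section \<open>Almost periodic functions that vanish at infinity\<close>

abbreviation inf_cge0 :: "complex filter" where
  "inf_cge0 \<equiv> inf at_infinity (principal cge0)"

text \<open>By simultaneous Diophantine approximation, a finite family of oscillations
  \<open>y \<mapsto> exp (- \<i> y t)\<close> comes back close to its value at \<open>y = 0\<close> at arbitrarily late times \<open>y\<close>.\<close>
lemma exponentials_nearly_return:
  assumes "finite T" "\<epsilon> > 0"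
  obtains y where "y \<ge> Y" "\<And>t. t \<in> T \<Longrightarrow> norm (exp (- (\<i> * of_real y) * of_real t) - 1) \<le> \<epsilon>"
proof -
  obtain n h where h: "T = h ` {i::nat. i < n}"
    using finite_imp_nat_seg_image_inj_on[OF assms(1)] by metis
  \<comment> \<open>The approximation theorem gives some positive integer, possibly \<open>1\<close>; scaling the frequencies
    by \<open>M\<close> makes the resulting time as late as required.\<close>
  define M where "M = max Y 1"
  obtain N :: nat where N: "N > 0" "2 * pi / N < \<epsilon>"
  proof -
    obtain N :: nat where "2 * pi / \<epsilon> < real N" using reals_Archimedean2 by blast
    moreover have "0 < 2 * pi / \<epsilon>" using assms(2) by simp
    ultimately have "0 < real N" by linarith
    with \<open>2 * pi / \<epsilon> < real N\<close> show thesis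
      using that[of N] assms(2) by (simp add: field_simps)
  qed
  obtain q p where q: "0 < q"
    and qp: "\<And>i. i < n \<Longrightarrow> \<bar>of_int q * (M * h i / (2 * pi)) - of_int (p i)\<bar> < 1 / N"
    using Dirichlet_approx_simult[OF N(1), of n "\<lambda>i. M * h i / (2 * pi)"] by metis
  show thesis
  proof (rule that[of "of_int q * M"])
    have "1 * M \<le> of_int q * M"
      by (rule mult_right_mono) (use q in \<open>auto simp: M_def\<close>)
    then show "Y \<le> of_int q * M" by (simp add: M_def)
    fix t assume "t \<in> T"
    then obtain i where i: "i < n" "t = h i" using h by auto
    define x where "x = 2 * pi * of_int (p i) - of_int q * M * t"
    have "x = - (2 * pi) * (of_int q * (M * h i / (2 * pi)) - of_int (p i))"
      by (simp add: x_def i field_simps)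
    then have "\<bar>x\<bar> = 2 * pi * \<bar>of_int q * (M * h i / (2 * pi)) - of_int (p i)\<bar>"
      by (simp add: abs_mult)
    also have "\<dots> \<le> 2 * pi * (1 / N)"
      by (rule mult_left_mono) (use qp[OF i(1)] in auto)
    also have "\<dots> \<le> \<epsilon>" using N by simp
    finally have x: "\<bar>x\<bar> \<le> \<epsilon>" .
    have "exp (- (\<i> * of_real (of_int q * M)) * of_real t) = exp (\<i> * of_real x)"
    proof -
      have "exp (- (\<i> * of_real (of_int q * M)) * of_real t)
          = exp (- (\<i> * of_real (of_int q * M)) * of_real t + 2 * of_int (p i) * of_real pi * \<i>)"
        using exp_plus_2pin[of "- (\<i> * of_real (of_int q * M)) * of_real t" "p i"]
        by (simp add: algebra_simps)
      also have "\<dots> = exp (\<i> * of_real x)"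
        by (simp add: x_def algebra_simps)
      finally show ?thesis .
    qed
    then have "norm (exp (- (\<i> * of_real (of_int q * M)) * of_real t) - 1) = 2 * \<bar>sin (x / 2)\<bar>"
      by (simp only: dist_exp_i_1)
    also have "\<dots> \<le> \<bar>x\<bar>" using abs_sin_x_le_abs_x[of "x/2"] by simp
    also note x
    finally show "norm (exp (- (\<i> * of_real (of_int q * M)) * of_real t) - 1) \<le> \<epsilon>" .
  qed
qed

text \<open>Up to a small error, every value of an almost periodic function recurs arbitrarily far up the
  vertical line through its argument, where the function is small by assumption. In particular
  \<^const>\<open>A0\<close> and \<^const>\<open>AP_plus\<close> meet only in zero.\<close>
lemma AP_plus_eq_zero_if_null_at_infinity:
  assumes f: "f \<in> AP_plus" and lim: "(f \<longlongrightarrow> 0) inf_cge0" and s: "s \<in> cge0"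
  shows "f s = 0"
proof -
  have "norm (f s) \<le> e" if "e > 0" for e
  proof -
    define \<epsilon> where "\<epsilon> = e / 4"
    have \<epsilon>: "\<epsilon> > 0" using that by (simp add: \<epsilon>_def)
    obtain p where p: "p \<in> exp_span" "\<And>s. s \<in> cge0 \<Longrightarrow> norm (f s - p s) \<le> \<epsilon>"
      using AP_approx[OF f \<epsilon>] by blast
    obtain T c where T: "finite T" "\<And>t. t \<in> T \<Longrightarrow> 0 \<le> t"
      "\<And>s. s \<in> cge0 \<Longrightarrow> p s = (\<Sum>t\<in>T. c t * exp (- s * complex_of_real t))"
      by (rule exp_spanE[OF p(1)]) blast
    \<comment> \<open>The summand \<open>1\<close> only makes \<open>C\<close> positive when all coefficients vanish.\<close>
    define C where "C = (\<Sum>t\<in>T. norm (c t)) + 1"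
    have C: "C > 0" unfolding C_def by (simp add: sum_nonneg add_nonneg_pos)
    have "\<forall>\<^sub>F z in inf_cge0. dist (f z) 0 < \<epsilon>"
      by (rule tendstoD[OF lim \<epsilon>])
    then obtain R where R: "\<And>z. norm z \<ge> R \<Longrightarrow> z \<in> cge0 \<Longrightarrow> norm (f z) < \<epsilon>"
      unfolding eventually_inf_principal eventually_at_infinity by auto
    obtain y where y: "y \<ge> R + norm s"
      "\<And>t. t \<in> T \<Longrightarrow> norm (exp (- (\<i> * of_real y) * of_real t) - 1) \<le> \<epsilon> / C"
      using exponentials_nearly_return[OF T(1), of "\<epsilon> / C" "R + norm s"] \<epsilon> C by auto
    define z where "z = s + \<i> * of_real y"
    have z: "z \<in> cge0" using s by (simp add: z_def cge0_def)
    have "norm z \<ge> R"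
    proof -
      have "norm (\<i> * of_real y) \<le> norm z + norm s"
        unfolding z_def using norm_triangle_ineq4[of "s + \<i> * of_real y" s] by simp
      then show ?thesis using y(1) by (simp add: norm_mult)
    qed
    then have fz: "norm (f z) < \<epsilon>" using R z by blast
    have "norm (p z - p s) \<le> (\<Sum>t\<in>T. norm (c t) * (\<epsilon> / C))"
      unfolding T(3)[OF z] T(3)[OF s] sum_subtractf[symmetric]
    proof (rule sum_norm_le)
      fix t assume t: "t \<in> T"
      have "c t * exp (- z * of_real t) - c t * exp (- s * of_real t)
          = c t * exp (- s * of_real t) * (exp (- (\<i> * of_real y) * of_real t) - 1)"
        unfolding z_def by (simp add: algebra_simps exp_add exp_diff exp_minus divide_inverse)
      moreover have "norm (exp (- s * of_real t)) \<le> 1"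
        using T(2)[OF t] s by (simp add: norm_exp_eq_Re cge0_def)
      ultimately show "norm (c t * exp (- z * of_real t) - c t * exp (- s * of_real t))
          \<le> norm (c t) * (\<epsilon> / C)"
        using y(2)[OF t] mult_mono[of "norm (c t) * norm (exp (- s * of_real t))" "norm (c t)"
            "norm (exp (- (\<i> * of_real y) * of_real t) - 1)" "\<epsilon> / C"]
        by (simp add: norm_mult mult_left_le)
    qed
    also have "\<dots> = (C - 1) * (\<epsilon> / C)" unfolding sum_distrib_right[symmetric] by (simp add: C_def)
    also have "\<dots> \<le> \<epsilon>" using C \<epsilon> by (simp add: field_simps)
    finally have pz: "norm (p z - p s) \<le> \<epsilon>" .
    have "norm (f s) \<le> norm (f s - p s) + norm (p z - p s) + norm (f z - p z) + norm (f z)"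
      by norm
    also have "\<dots> \<le> \<epsilon> + \<epsilon> + \<epsilon> + \<epsilon>"
      using p(2)[OF s] p(2)[OF z] pz fz by linarith
    finally show ?thesis by (simp add: \<epsilon>_def)
  qed
  then show ?thesis by (metis norm_le_zero_iff dense_ge)
qed

section \<open>Almost periodic parts of factors\<close>
lemma A0_AP_if_limit_at_infinity:
  assumes "f holomorphic_on cgt0" "continuous_on cge0 f" "(f \<longlongrightarrow> c) inf_cge0"
  shows "(\<lambda>s\<in>cge0. f s) \<in> A0_AP"
proof -
  have "(\<lambda>s\<in>cge0. f s - c) \<in> A0"
    by (rule A0_I) (use assms tendsto_diff[OF assms(3) tendsto_const[of c]] in
      \<open>auto intro!: holomorphic_intros continuous_intros\<close>)
  moreover have "(\<lambda>s\<in>cge0. c) \<in> AP_plus"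
    using exp_span_const exp_span_subset_AP by blast
  moreover have "(\<lambda>s\<in>cge0. f s) = (\<lambda>s\<in>cge0. (\<lambda>s\<in>cge0. f s - c) s + (\<lambda>s\<in>cge0. c) s)"
    by (auto simp: fun_eq_iff restrict_def)
  ultimately show ?thesis unfolding A0_AP_def by blast
qed

lemma AP_plus_subset_A0_AP: "AP_plus \<subseteq> A0_AP"
proof
  fix f assume f: "f \<in> AP_plus"
  then have "f = (\<lambda>s\<in>cge0. (\<lambda>s\<in>cge0. 0) s + f s)"
    by (auto simp: AP_plus_def fun_eq_iff restrict_def extensional_def)
  then show "f \<in> A0_AP" unfolding A0_AP_def using f A0_zero by blast
qed

lemma A0_times_AP_null_at_infinity:
  assumes "f \<in> A0" "g \<in> AP_plus" shows "((\<lambda>s. f s * g s) \<longlongrightarrow> 0) inf_cge0"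
proof -
  have "((\<lambda>s\<in>cge0. f s * g s) \<longlongrightarrow> 0) inf_cge0"
    using A0_mult_AP[OF assms] by (simp add: A0_def)
  then show ?thesis
    by (rule Lim_transform_eventually) (use eventually_cge0 in \<open>auto elim!: eventually_mono\<close>)
qed

text \<open>All terms of the product that involve an \<^const>\<open>A0\<close> part vanish at infinity, so
  \<open>k' d' - 1\<close> is an almost periodic function that vanishes there.\<close>
lemma AP_parts_inverse_if_product_tends_to_1:
  assumes k: "k \<in> A0" "k' \<in> AP_plus" and d: "d \<in> A0" "d' \<in> AP_plus"
    and lim: "((\<lambda>s. (k s + k' s) * (d s + d' s)) \<longlongrightarrow> 1) inf_cge0"
    and s: "s \<in> cge0"
  shows "k' s * d' s = 1"
proof -
  have k0: "(k \<longlongrightarrow> 0) inf_cge0" and d0: "(d \<longlongrightarrow> 0) inf_cge0"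
    using k(1) d(1) by (auto simp: A0_def)
  have "((\<lambda>s. (k s + k' s) * (d s + d' s) - k s * d s - k s * d' s - d s * k' s - 1)
      \<longlongrightarrow> 1 - 0 * 0 - 0 - 0 - 1) inf_cge0"
    by (intro tendsto_intros lim k0 d0 A0_times_AP_null_at_infinity k d)
  then have lim': "((\<lambda>s. k' s * d' s - 1) \<longlongrightarrow> 0) inf_cge0"
    by (simp add: algebra_simps)
  define f where "f = (\<lambda>s\<in>cge0. (\<lambda>s\<in>cge0. k' s * d' s) s + (\<lambda>s\<in>cge0. - 1) s)"
  have f: "f \<in> AP_plus"
    unfolding f_def
    by (rule AP_add[OF AP_mult[OF k(2) d(2)] subsetD[OF exp_span_subset_AP exp_span_const]])
  have "(f \<longlongrightarrow> 0) inf_cge0"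
    using lim' by (rule Lim_transform_eventually)
      (use eventually_cge0 in \<open>auto simp: f_def elim!: eventually_mono\<close>)
  from AP_plus_eq_zero_if_null_at_infinity[OF f this s] show ?thesis
    using s by (simp add: f_def)
qed

section \<open>Square roots on the half plane, continuous up to infinity\<close>
lemma tendsto_recip_cge0:
  "((\<lambda>s::complex. 1 / (s + a)) \<longlongrightarrow> 0) inf_cge0"
proof -
  have "filterlim (\<lambda>s. s + a) at_infinity inf_cge0"
    by (intro tendsto_add_filterlim_at_infinity'[OF _ tendsto_const]) (auto simp: filterlim_def)
  then show ?thesis by (intro tendsto_divide_0[OF tendsto_const])
qed

text \<open>The map \<open>s \<mapsto> 1 / (s + 1)\<close>, with inverse \<open>w \<mapsto> 1 / w - 1\<close>, carries the closed half plane to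
  a closed disc without the boundary point \<open>0\<close>, which takes the place of infinity, and carries \<open>0\<close>
  to \<open>1\<close>.\<close>
lemma recip_minus_one_in_cge0_iff:
  assumes "w \<noteq> 0" shows "1 / w - 1 \<in> cge0 \<longleftrightarrow> w \<in> cball (1/2) (1/2)"
proof -
  have n: "0 < (norm w)\<^sup>2" using assms by simp
  have "1 / w - 1 \<in> cge0 \<longleftrightarrow> (norm w)\<^sup>2 \<le> Re w"
    using n by (simp add: cge0_def Re_divide cmod_power2 field_simps)
  also have "\<dots> \<longleftrightarrow> (norm (1/2 - w))\<^sup>2 \<le> (1/2)\<^sup>2"
  proof -
    have "(norm (1/2 - w))\<^sup>2 = (norm w)\<^sup>2 - Re w + (1/2)\<^sup>2"
      unfolding cmod_power2 by (simp add: power2_eq_square algebra_simps)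
    then show ?thesis by simp
  qed
  also have "\<dots> \<longleftrightarrow> w \<in> cball (1/2) (1/2)"
    unfolding mem_cball dist_norm by (subst abs_le_square_iff[symmetric]) simp
  finally show ?thesis .
qed

text \<open>The puncture \<open>1\<close> lies on the boundary circle, so no segment from the centre passes through
  it before it ends.\<close>
lemma punctured_disc_contractible: "contractible (cball (1/2::complex) (1/2) - {1})"
proof (rule starlike_imp_contractible, unfold starlike_def, intro bexI[of _ "1/2"] ballI)
  fix x :: complex assume x: "x \<in> cball (1/2) (1/2) - {1}"
  show "closed_segment (1/2) x \<subseteq> cball (1/2) (1/2) - {1}"
  proof
    fix z assume z: "z \<in> closed_segment (1/2) x"
    then obtain t where t: "0 \<le> t" "t \<le> 1" "z = (1 - t) *\<^sub>R (1/2) + t *\<^sub>R x"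
      by (auto simp: closed_segment_def)
    have "z \<in> cball (1/2) (1/2)"
      using closed_segment_subset[OF _ _ convex_cball, of "1/2::complex" "1/2" "1/2" x] x z by auto
    moreover have "z \<noteq> 1"
    proof
      assume "z = 1"
      then have "t *\<^sub>R (x - 1/2) = 1/2"
        using t(3) by (simp add: scaleR_conv_of_real field_simps)
      then have "t * norm (x - 1/2) = 1/2"
        by (metis norm_scaleR abs_of_nonneg t(1) norm_divide norm_one norm_numeral)
      moreover have "norm (x - 1/2) \<le> 1/2" using x by (simp add: dist_norm norm_minus_commute)
      ultimately have "t \<ge> 1" using t mult_left_mono[of "norm (x - 1/2)" "1/2" t] by linarith
      with t \<open>z = 1\<close> x show False by simp
    qed
    ultimately show "z \<in> cball (1/2) (1/2) - {1}" by simp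
  qed
qed (auto simp: dist_norm)

text \<open>The difference quotient of \<open>r\<close> is that of \<open>r\<^sup>2\<close> divided by \<open>r x + r z\<close>, which converges to
  \<open>2 r z \<noteq> 0\<close>.\<close>
lemma holomorphic_on_continuous_sqrt:
  fixes r u :: "complex \<Rightarrow> complex"
  assumes "open S" "u holomorphic_on S" "continuous_on S r"
    and sq: "\<And>z. z \<in> S \<Longrightarrow> u z = r z ^ 2" and nz: "\<And>z. z \<in> S \<Longrightarrow> u z \<noteq> 0"
  shows "r holomorphic_on S"
  unfolding holomorphic_on_open[OF assms(1)]
proof (intro ballI allI impI)
  fix z assume z: "z \<in> S"
  obtain D where D: "(u has_field_derivative D) (at z)"
    using assms(1,2) z holomorphic_on_open by blast
  have rz: "r z \<noteq> 0" using sq nz z by fastforce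
  have cont: "(r \<longlongrightarrow> r z) (at z)"
    using assms(1,3) z by (simp add: continuous_on_eq_continuous_at isCont_def)
  have "((\<lambda>x. (u x - u z) / (x - z) / (r x + r z)) \<longlongrightarrow> D / (r z + r z)) (at z)"
    using D rz unfolding has_field_derivative_iff by (intro tendsto_intros cont) auto
  moreover have "\<forall>\<^sub>F x in at z. (u x - u z) / (x - z) / (r x + r z) = (r x - r z) / (x - z)"
  proof -
    have "\<forall>\<^sub>F x in at z. r x + r z \<noteq> 0"
      by (rule tendsto_imp_eventually_ne[OF tendsto_add[OF cont tendsto_const]]) (use rz in simp)
    moreover have "\<forall>\<^sub>F x in at z. x \<in> S"
      using assms(1) z by (rule eventually_at_in_open')
    ultimately show ?thesis
    proof eventually_elim
      case (elim x)
      have "u x - u z = (r x - r z) * (r x + r z)"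
        using sq elim z by (simp add: algebra_simps power2_eq_square)
      then show ?case using elim by simp
    qed
  qed
  ultimately have "((\<lambda>x. (r x - r z) / (x - z)) \<longlongrightarrow> D / (r z + r z)) (at z)"
    by (rule Lim_transform_eventually)
  then show "\<exists>f'. (r has_field_derivative f') (at z)"
    unfolding has_field_derivative_iff by blast
qed

text \<open>Moving the problem to the disc \<open>D\<close> turns infinity into the ordinary point \<open>0\<close> of the
  contractible set \<open>D - {1}\<close>, so a continuous square root on that set has a limit at infinity for
  free. At the excluded zero, continuity of the root follows from its modulus.\<close>
lemma sqrt_on_half_plane:
  assumes hol: "u holomorphic_on cgt0" and cont: "continuous_on cge0 u"
    and lim: "(u \<longlongrightarrow> c) inf_cge0" and c: "c \<noteq> 0"
    and nz: "\<And>s. s \<in> cge0 \<Longrightarrow> u s = 0 \<longleftrightarrow> s = 0"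
  obtains r c' where "r holomorphic_on cgt0" "continuous_on cge0 r" "(r \<longlongrightarrow> c') inf_cge0"
    "\<And>s. s \<in> cge0 \<Longrightarrow> u s = r s ^ 2"
proof -
  define D where "D = cball (1/2::complex) (1/2)"
  define v where "v = (\<lambda>w. if w = 0 then c else u (1 / w - 1))"
  have inD: "1 / (s + 1) \<in> D - {0}" if "s \<in> cge0" for s
  proof -
    have "s + 1 \<noteq> 0" using that by (auto simp: cge0_def complex_eq_iff)
    then show ?thesis using recip_minus_one_in_cge0_iff[of "1 / (s + 1)"] that by (simp add: D_def)
  qed
  have v_u: "v (1 / (s + 1)) = u s" if "s \<in> cge0" for s
    using inD[OF that] by (simp add: v_def)
  have outD: "1 / w - 1 \<in> cge0" if "w \<in> D - {0}" for w
    using recip_minus_one_in_cge0_iff[of w] that by (simp add: D_def)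
  have "continuous_on D v"
    unfolding continuous_on_def
  proof
    fix w assume w: "w \<in> D"
    show "(v \<longlongrightarrow> v w) (at w within D)"
    proof (cases "w = 0")
      case True
      have "filterlim (\<lambda>w. inverse w) at_infinity (at 0 within D)"
        by (rule filterlim_inverse_at_infinity[THEN filterlim_mono])
          (auto intro: at_le)
      then have "filterlim (\<lambda>w. inverse w + (- 1)) at_infinity (at 0 within D)"
        by (intro tendsto_add_filterlim_at_infinity'[OF _ tendsto_const]) auto
      moreover have "\<forall>\<^sub>F w in at 0 within D. inverse w + (- 1) \<in> cge0"
        unfolding eventually_at_filter using outD by (auto simp: divide_inverse)
      ultimately have "filterlim (\<lambda>w. inverse w + (- 1)) inf_cge0 (at 0 within D)"
        by (simp add: filterlim_inf filterlim_principal)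
      from filterlim_compose[OF lim this]
      have "((\<lambda>w. u (inverse w + (- 1))) \<longlongrightarrow> c) (at 0 within D)" .
      then show ?thesis unfolding True
        by (rule Lim_transform_eventually[THEN tendsto_eq_rhs])
          (auto simp: v_def eventually_at_filter divide_inverse)
    next
      case False
      have "continuous_on (D - {0}) (\<lambda>w. u (1 / w - 1))"
        by (rule continuous_on_compose2[OF cont]) (use outD in \<open>auto intro!: continuous_intros\<close>)
      then have "continuous_on (D - {0}) v"
        by (rule continuous_on_eq) (auto simp: v_def)
      then have "(v \<longlongrightarrow> v w) (at w within D - {0})"
        using w False by (auto simp: continuous_on_def)
      moreover have "at w within D - {0} = at w within D"
        by (rule at_within_nhd[of _ "- {0}"]) (use False in auto)
      ultimately show ?thesis by simp
    qed
  qed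
  moreover have "v w \<noteq> 0" if "w \<in> D - {1}" for w
  proof (cases "w = 0")
    case False
    then have "1 / w - 1 \<noteq> 0" using that by auto
    then show ?thesis using nz[of "1 / w - 1"] outD[of w] that False by (auto simp: v_def)
  qed (use c in \<open>simp add: v_def\<close>)
  ultimately obtain g where g: "continuous_on (D - {1}) g" "\<And>w. w \<in> D - {1} \<Longrightarrow> v w = g w ^ 2"
    using continuous_sqrt_on_contractible[OF continuous_on_subset[of D v] punctured_disc_contractible]
    unfolding D_def by blast
  define r where "r = (\<lambda>s. if s = 0 then 0 else g (1 / (s + 1)))"
  have in1: "1 / (s + 1) \<in> D - {1}" if "s \<in> cge0 - {0}" for s
    using inD[of s] that by (auto simp: divide_eq_1_iff)
  have sq: "u s = r s ^ 2" if "s \<in> cge0" for s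
    using g(2)[OF in1, of s] v_u[of s] that nz[of s] by (auto simp: r_def)
  have cne: "continuous_on (cge0 - {0}) r"
  proof -
    have "continuous_on (cge0 - {0}) (\<lambda>s. 1 / (s + 1))"
      by (intro continuous_intros) (use inD in fastforce)
    then have "continuous_on (cge0 - {0}) (\<lambda>s. g (1 / (s + 1)))"
      by (rule continuous_on_compose2[OF g(1)]) (use in1 in auto)
    then show ?thesis by (rule continuous_on_eq) (auto simp: r_def)
  qed
  have cr: "continuous_on cge0 r"
    unfolding continuous_on_def
  proof
    fix s assume s: "s \<in> cge0"
    show "(r \<longlongrightarrow> r s) (at s within cge0)"
    proof (cases "s = 0")
      case True
      have "((\<lambda>x. sqrt (norm (u x))) \<longlongrightarrow> sqrt (norm (u 0))) (at 0 within cge0)"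
        using cont s True by (intro tendsto_intros) (auto simp: continuous_on_def)
      then have "((\<lambda>x. norm (r x)) \<longlongrightarrow> sqrt (norm (u 0))) (at 0 within cge0)"
        by (rule Lim_transform_eventually)
          (auto simp: eventually_at_filter sq norm_power)
      then show ?thesis
        using nz[OF s] True by (simp add: r_def tendsto_norm_zero_iff)
    next
      case False
      then have "(r \<longlongrightarrow> r s) (at s within cge0 - {0})"
        using cne s by (auto simp: continuous_on_def)
      moreover have "at s within cge0 - {0} = at s within cge0"
        by (rule at_within_nhd[of _ "- {0}"]) (use False in auto)
      ultimately show ?thesis by simp
    qed
  qed
  have "r holomorphic_on cgt0"
    by (rule holomorphic_on_continuous_sqrt[OF open_cgt0 hol])
      (use cr cgt0_subset sq nz in \<open>auto intro: continuous_on_subset simp: cgt0_def\<close>)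
  moreover have "(r \<longlongrightarrow> g 0) inf_cge0"
  proof -
    have ev: "\<forall>\<^sub>F s in inf_cge0. s \<in> cge0 - {0}"
      unfolding eventually_inf_principal eventually_at_infinity by (auto intro!: exI[of _ 1])
    then have "\<forall>\<^sub>F s in inf_cge0. 1 / (s + 1) \<in> D - {1} \<and> 1 / (s + 1) \<noteq> 0"
      by (rule eventually_mono) (use in1 inD in auto)
    then have "filterlim (\<lambda>s. 1 / (s + 1)) (at 0 within D - {1}) inf_cge0"
      using tendsto_recip_cge0[of 1] by (simp add: filterlim_at)
    moreover have "(g \<longlongrightarrow> g 0) (at 0 within D - {1})"
      using g(1) by (auto simp: continuous_on_def D_def)
    ultimately have "((\<lambda>s. g (1 / (s + 1))) \<longlongrightarrow> g 0) inf_cge0"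
      by (rule filterlim_compose[rotated])
    then show ?thesis
      by (rule Lim_transform_eventually, intro eventually_mono[OF ev]) (auto simp: r_def)
  qed
  ultimately show thesis using that cr sq by blast
qed


section \<open>The discontinuous inner function\<close>
lemma tendsto_exp_recip:
  "((\<lambda>s::complex. exp (- (1 / s))) \<longlongrightarrow> 1) inf_cge0"
  using tendsto_exp[OF tendsto_minus[OF tendsto_recip_cge0[of 0]]] by simp

lemma norm_exp_recip_le:
  assumes "s \<in> cge0" shows "norm (exp (- (1 / s))) \<le> 1"
  using assms by (simp add: norm_exp_eq_Re cge0_def Re_divide)

text \<open>The oscillation of \<open>exp (- 1 / s)\<close> at \<open>0\<close> is damped by the zero of \<open>r\<close>.\<close>
lemma A0_AP_times_exp_recip:
  assumes hol: "r holomorphic_on cgt0" and cont: "continuous_on cge0 r"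
    and lim: "(r \<longlongrightarrow> c) inf_cge0" and r0: "r 0 = 0"
  shows "(\<lambda>s\<in>cge0. r s * exp (- (1 / s))) \<in> A0_AP"
proof (rule A0_AP_if_limit_at_infinity)
  show "(\<lambda>s. r s * exp (- (1 / s))) holomorphic_on cgt0"
    by (intro holomorphic_intros hol) (auto simp: cgt0_def)
  show "((\<lambda>s. r s * exp (- (1 / s))) \<longlongrightarrow> c * 1) inf_cge0"
    by (intro tendsto_intros lim tendsto_exp_recip)
  show "continuous_on cge0 (\<lambda>s. r s * exp (- (1 / s)))"
    unfolding continuous_on_def
  proof
    fix s assume s: "s \<in> cge0"
    show "((\<lambda>s. r s * exp (- (1 / s))) \<longlongrightarrow> r s * exp (- (1 / s))) (at s within cge0)"
    proof (cases "s = 0")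
      case False
      then show ?thesis
        using cont s by (intro tendsto_intros) (auto simp: continuous_on_def)
    next
      case True
      have "((\<lambda>s. norm (r s)) \<longlongrightarrow> 0) (at 0 within cge0)"
        using cont s True r0 by (intro tendsto_norm_zero) (auto simp: continuous_on_def)
      moreover have "\<forall>\<^sub>F s in at 0 within cge0. norm (r s * exp (- (1 / s))) \<le> norm (r s)"
        unfolding eventually_at_filter
        by (rule always_eventually) (use norm_exp_recip_le in \<open>auto simp: norm_mult mult_left_le\<close>)
      ultimately have "((\<lambda>s. r s * exp (- (1 / s))) \<longlongrightarrow> 0) (at 0 within cge0)"
        by (rule Lim_null_comparison[rotated])
      then show ?thesis using True r0 by simp
    qed
  qed
qed

text \<open>As \<open>s\<close> tends to \<open>0\<close> along the positive reals, \<open>exp (- 1 / s)\<close> tends to \<open>0\<close>, which forces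
  \<open>l 0 = 0\<close>; along the imaginary axis it has modulus \<open>1\<close>, which forces \<open>\<bar>k 0\<bar> = \<bar>l 0\<bar>\<close>.\<close>
lemma zero_if_exp_recip_multiple_continuous:
  assumes k: "continuous_on cge0 k" and l: "continuous_on cge0 l"
    and eq: "\<And>s. s \<in> cge0 - {0} \<Longrightarrow> l s = k s * exp (- (1 / s))"
  shows "k 0 = 0"
proof -
  have seq: "(\<lambda>n. f (z n)) \<longlonglongrightarrow> f 0"
    if "continuous_on cge0 f" "z \<longlonglongrightarrow> 0" "\<And>n. z n \<in> cge0" for f :: "complex \<Rightarrow> complex" and z
    using that continuous_on_tendsto_compose[of cge0 f z 0 sequentially] by (auto simp: cge0_def)
  define x where "x = (\<lambda>n. complex_of_real (1 / real (Suc n)))"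
  have lim0: "(\<lambda>n. 1 / real (Suc n)) \<longlonglongrightarrow> 0"
    using LIMSEQ_inverse_real_of_nat by (simp add: divide_inverse)
  have x0: "x \<longlonglongrightarrow> 0"
    unfolding x_def using tendsto_of_real[OF lim0, where ?'a = complex] by simp
  have x: "x n \<in> cge0 - {0}" "\<i> * x n \<in> cge0 - {0}" for n
    by (auto simp: x_def cge0_def simp del: of_nat_Suc)
  have "(\<lambda>n. l (x n)) \<longlonglongrightarrow> k 0 * 0"
  proof -
    have "(\<lambda>n. exp (- real (Suc n))) \<longlonglongrightarrow> 0"
      by (rule filterlim_compose[OF exp_at_bot])
        (use filterlim_compose[OF filterlim_uminus_at_bot_at_top
           filterlim_compose[OF filterlim_real_sequentially filterlim_Suc]] in simp)
    from tendsto_of_real[OF this, where ?'a = complex]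
    have "(\<lambda>n. exp (- (1 / x n))) \<longlonglongrightarrow> 0"
      by (simp add: x_def exp_of_real[symmetric])
    then have "(\<lambda>n. k (x n) * exp (- (1 / x n))) \<longlonglongrightarrow> k 0 * 0"
      using seq[OF k x0] x by (intro tendsto_intros) auto
    then show ?thesis using eq[OF x(1)] by simp
  qed
  moreover have "(\<lambda>n. l (x n)) \<longlonglongrightarrow> l 0" using seq[OF l x0] x by auto
  ultimately have l0: "l 0 = 0" using LIMSEQ_unique by fastforce
  have ix0: "(\<lambda>n. \<i> * x n) \<longlonglongrightarrow> 0"
    using tendsto_mult[OF tendsto_const x0, of \<i>] by simp
  have "norm (l (\<i> * x n)) = norm (k (\<i> * x n))" for n
    using eq[OF x(2)[of n]] by (simp add: norm_mult norm_exp_eq_Re x_def Re_divide)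
  moreover have "(\<lambda>n. norm (l (\<i> * x n))) \<longlonglongrightarrow> norm (l 0)"
    by (rule tendsto_norm[OF seq[OF l ix0 DiffD1[OF x(2)]]])
  moreover have "(\<lambda>n. norm (k (\<i> * x n))) \<longlonglongrightarrow> norm (k 0)"
    by (rule tendsto_norm[OF seq[OF k ix0 DiffD1[OF x(2)]]])
  ultimately have "norm (k 0) = norm (l 0)" using LIMSEQ_unique by fastforce
  with l0 show ?thesis by simp
qed

section \<open>The pair without a greatest common divisor\<close>
lemma divides_A0_AP_ring:
  "f divides\<^bsub>A0_AP_ring\<^esub> g \<longleftrightarrow> (\<exists>h\<in>A0_AP. g = (\<lambda>s\<in>cge0. f s * h s))"
  by (simp add: factor_def A0_AP_ring_def)

text \<open>With \<open>d2\<close> the almost periodic part of \<open>d\<close>, the function \<open>u = k d2\<close> has a limit at infinity and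
  hence a square root of the same kind; the almost periodic part of \<open>k\<close> undoes the multiplication
  by \<open>d2\<close>.\<close>
lemma splits_into_square_times_AP:
  assumes k: "k \<in> A0_AP" and d: "d \<in> A0_AP"
    and lim: "((\<lambda>s. k s * d s) \<longlongrightarrow> 1) inf_cge0"
    and nz: "\<And>s. s \<in> cge0 - {0} \<Longrightarrow> k s * d s \<noteq> 0" and k0: "k 0 = 0"
  obtains r c h where "r holomorphic_on cgt0" "continuous_on cge0 r" "(r \<longlongrightarrow> c) inf_cge0"
    "r 0 = 0" "h \<in> AP_plus" "\<And>s. s \<in> cge0 \<Longrightarrow> k s = r s ^ 2 * h s"
proof -
  obtain k1 k2 where k12: "k1 \<in> A0" "k2 \<in> AP_plus" and k_eq: "k = (\<lambda>s\<in>cge0. k1 s + k2 s)"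
    by (rule A0_APE[OF k])
  obtain d1 d2 where d12: "d1 \<in> A0" "d2 \<in> AP_plus" and d_eq: "d = (\<lambda>s\<in>cge0. d1 s + d2 s)"
    by (rule A0_APE[OF d])
  have "((\<lambda>s. (k1 s + k2 s) * (d1 s + d2 s)) \<longlongrightarrow> 1) inf_cge0"
    using lim by (rule Lim_transform_eventually)
      (use eventually_cge0 in \<open>auto simp: k_eq d_eq elim!: eventually_mono\<close>)
  then have inv: "k2 s * d2 s = 1" if "s \<in> cge0" for s
    using AP_parts_inverse_if_product_tends_to_1[OF k12 d12 _ that] by blast
  define u where "u = (\<lambda>s. k s * d2 s)"
  have "((\<lambda>s. k1 s * d2 s + 1) \<longlongrightarrow> 0 + 1) inf_cge0"
    by (intro tendsto_intros A0_times_AP_null_at_infinity k12 d12)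
  then have u1: "(u \<longlongrightarrow> 1) inf_cge0"
    unfolding add_0 by (rule Lim_transform_eventually, intro eventually_mono[OF eventually_cge0])
      (simp add: u_def k_eq inv distrib_right)
  have u0: "u s = 0 \<longleftrightarrow> s = 0" if "s \<in> cge0" for s
    using nz[of s] inv[OF that] that k0 by (auto simp: u_def)
  have "u holomorphic_on cgt0" "continuous_on cge0 u"
    unfolding u_def
    by (intro holomorphic_intros continuous_intros A0_AP_holomorphic A0_AP_continuous
        AP_holomorphic AP_continuous k d12)+
  then obtain r c where r: "r holomorphic_on cgt0" "continuous_on cge0 r" "(r \<longlongrightarrow> c) inf_cge0"
    "\<And>s. s \<in> cge0 \<Longrightarrow> u s = r s ^ 2"
    using sqrt_on_half_plane[OF _ _ u1 one_neq_zero u0] by blast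
  have 0: "0 \<in> cge0" by (simp add: cge0_def)
  show thesis
  proof (rule that[OF r(1-3) _ k12(2)])
    show "r 0 = 0" using r(4)[OF 0] u0[OF 0] by simp
    fix s assume s: "s \<in> cge0"
    have "k s = k s * (k2 s * d2 s)" using inv[OF s] by simp
    also have "\<dots> = u s * k2 s" by (simp add: u_def)
    finally show "k s = r s ^ 2 * k2 s" using r(4)[OF s] by simp
  qed
qed

theorem theorem6p3:
  shows "\<not> gcd_domain A0_AP_ring"
proof
  assume "gcd_domain A0_AP_ring"
  then interpret gcd_domain A0_AP_ring .
  define q :: "complex \<Rightarrow> complex" where "q = (\<lambda>s. s / (s + 1))"
  have ne: "s + 1 \<noteq> 0" if "s \<in> cge0" for s
    using that by (auto simp: cge0_def complex_eq_iff)
  have q: "q holomorphic_on cgt0" "continuous_on cge0 q" "(q \<longlongrightarrow> 1) inf_cge0" "q 0 = 0"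
    "\<And>s. s \<in> cge0 - {0} \<Longrightarrow> q s \<noteq> 0"
  proof -
    show "q holomorphic_on cgt0" "continuous_on cge0 q"
      unfolding q_def using ne cgt0_subset
      by (auto intro!: holomorphic_intros continuous_intros)
    have "((\<lambda>s. 1 - 1 / (s + 1)) \<longlongrightarrow> 1 - 0) inf_cge0"
      by (intro tendsto_intros tendsto_recip_cge0)
    then show "(q \<longlongrightarrow> 1) inf_cge0"
      unfolding diff_0_right
      by (rule Lim_transform_eventually, intro eventually_mono[OF eventually_cge0])
        (use ne in \<open>auto simp: q_def field_simps\<close>)
  qed (use ne in \<open>auto simp: q_def\<close>)
  define a where "a = (\<lambda>s\<in>cge0. q s)"
  define b where "b = (\<lambda>s\<in>cge0. q s * exp (- (1 / s)))"
  have "a \<in> A0_AP" "b \<in> A0_AP"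
    unfolding a_def b_def
    using A0_AP_if_limit_at_infinity[OF q(1-3)] A0_AP_times_exp_recip[OF q(1-4)] by auto
  then obtain d where d: "d \<in> A0_AP" and gcd: "d gcdof\<^bsub>A0_AP_ring\<^esub> a b"
    using gcd_exists[of a b] by (auto simp: A0_AP_ring_def)
  from gcd obtain k l where k: "k \<in> A0_AP" "a = (\<lambda>s\<in>cge0. d s * k s)"
    and l: "l \<in> A0_AP" "b = (\<lambda>s\<in>cge0. d s * l s)"
    by (auto simp: isgcd_def divides_A0_AP_ring)
  have dk: "d s * k s = q s" if "s \<in> cge0" for s
    using fun_cong[OF k(2), of s] that by (simp add: a_def)
  have dl: "d s * l s = q s * exp (- (1 / s))" if "s \<in> cge0" for s
    using fun_cong[OF l(2), of s] that by (simp add: b_def)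
  have dnz: "d s \<noteq> 0" if "s \<in> cge0 - {0}" for s
    using dk[of s] q(5)[OF that] that by auto
  have "l s = k s * exp (- (1 / s))" if "s \<in> cge0 - {0}" for s
  proof -
    have "d s * l s = d s * (k s * exp (- (1 / s)))"
      using that dl[of s] by (simp add: dk[symmetric])
    then show ?thesis using dnz[OF that] by simp
  qed
  then have k0: "k 0 = 0"
    by (rule zero_if_exp_recip_multiple_continuous[OF A0_AP_continuous[OF k(1)]
          A0_AP_continuous[OF l(1)]])
  have "((\<lambda>s. k s * d s) \<longlongrightarrow> 1) inf_cge0"
    by (rule Lim_transform_eventually[OF q(3)], intro eventually_mono[OF eventually_cge0])
      (simp add: dk[symmetric] mult.commute)
  moreover have "k s * d s \<noteq> 0" if "s \<in> cge0 - {0}" for s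
    using dk[of s] q(5)[OF that] that by (simp add: mult.commute)
  ultimately obtain r c h where r: "r holomorphic_on cgt0" "continuous_on cge0 r"
      "(r \<longlongrightarrow> c) inf_cge0" "r 0 = 0"
    and h: "h \<in> AP_plus" and k_eq: "\<And>s. s \<in> cge0 \<Longrightarrow> k s = r s ^ 2 * h s"
    using splits_into_square_times_AP[OF k(1) d _ _ k0] by blast
  define R where "R = (\<lambda>s\<in>cge0. r s)"
  define E where "E = (\<lambda>s\<in>cge0. r s * exp (- (1 / s)))"
  have R: "R \<in> A0_AP" and E: "E \<in> A0_AP"
    unfolding R_def E_def
    using A0_AP_if_limit_at_infinity[OF r(1-3)] A0_AP_times_exp_recip[OF r] by auto
  have hA: "h \<in> A0_AP" using h AP_plus_subset_A0_AP by blast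
  \<comment> \<open>A common divisor of \<open>a\<close> and \<open>b\<close> that vanishes at \<open>0\<close> to a higher order than \<open>d\<close>.\<close>
  define y where "y = (\<lambda>s\<in>cge0. d s * R s)"
  have y: "y \<in> A0_AP" unfolding y_def by (rule A0_AP_mult[OF d R])
  have "y divides\<^bsub>A0_AP_ring\<^esub> a"
    unfolding divides_A0_AP_ring
  proof (intro bexI[OF _ A0_AP_mult[OF R hA]])
    show "a = (\<lambda>s\<in>cge0. y s * (\<lambda>s\<in>cge0. R s * h s) s)"
      by (auto simp: a_def y_def R_def dk[symmetric] k_eq power2_eq_square intro!: restrict_ext)
  qed
  moreover have "y divides\<^bsub>A0_AP_ring\<^esub> b"
    unfolding divides_A0_AP_ring
  proof (intro bexI[OF _ A0_AP_mult[OF E hA]])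
    show "b = (\<lambda>s\<in>cge0. y s * (\<lambda>s\<in>cge0. E s * h s) s)"
      by (auto simp: b_def y_def R_def E_def dk[symmetric] k_eq power2_eq_square intro!: restrict_ext)
  qed
  ultimately have "y divides\<^bsub>A0_AP_ring\<^esub> d"
    using gcd y by (auto simp: isgcd_def A0_AP_ring_def)
  then obtain m where m: "m \<in> A0_AP" "d = (\<lambda>s\<in>cge0. y s * m s)"
    unfolding divides_A0_AP_ring by blast
  have rm: "r s * m s = 1" if "s \<in> cge0 - {0}" for s
  proof -
    have "d s * (r s * m s) = d s * 1"
      using fun_cong[OF m(2), of s] that by (simp add: y_def R_def)
    then show ?thesis using dnz[OF that] by (metis mult_left_cancel)
  qed
  have "continuous_on cge0 (\<lambda>s. r s * m s)"
    by (intro continuous_intros r A0_AP_continuous m)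
  from continuous_constant_on_closure[OF continuous_on_subset[OF this], of cgt0 1 0]
  have "r 0 * m 0 = 1"
    using rm cgt0_subset closure_cgt0 by (force simp: cgt0_def cge0_def)
  with r(4) show False by simp
qed

end
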